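(* Let $k$ be a positive integer. Let $G$ and $H$ be bipartite graphs with bipartitions $(A_G,B_G)$ and $(A_H,B_H)$, respectively, such that $H$ is a bipartite correspondence-cover of $G$ with respect to some $L: A_G\to 2^{A_H},\ B_G\to 2^{B_H}$. If $H$ has maximum degree $1$ in part $A_H$ and maximum degree at most $k^{k-2}/e$ in part $B_H$, and $|L(v)| \ge k$ for all $v\in V(G)$, then $H$ admits an independent transversal with respect to $L$.
   Context: Graphs are simple and undirected. $e$ is the base of the natural logarithm. Let $G$ and $H$ be bipartite graphs with bipartitions $(A_G,B_G)$ and $(A_H,B_H)$. $H$ is a bipartite cover of $G$ with respect to a mapping $L:V(G)\to 2^{V(H)}$ if: (a) $L$ induces a partition of $V(H)$, i.e. the sets $L(v)$, $v\in V(G)$, are nonempty, pairwise disjoint and have union $V(H)$, and there are no edges of $H$ between $L(v)$ and $L(v')$ whenever $vv'\notin E(G)$; and (b) the sets $L(v)$, $v\in A_G$, partition $A_H$ and the sets $L(w)$, $w\in B_G$, partition $B_H$ (this is what is meant by writing $L: A_G\to 2^{A_H}, B_G\to 2^{B_H}$). It is a bipartite correspondence-cover if, in addition, for each edge $vv'\in E(G)$ the subgraph of $H$ between $L(v)$ and $L(v')$ is a matching (not necessarily perfect, possibly empty). An independent transversal of $H$ with respect to $L$ is an independent set of $H$ that contains exactly one vertex of each $L(v)$, $v\in V(G)$. The maximum degree of $H$ in part $A_H$ (resp. $B_H$) is the maximum over vertices in that part of their degree in $H$. *)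

theory Defs
  imports Complex_Main "HOL-Library.Disjoint_Sets" "HOL-Library.Extended_Real"
begin

record 'a ugraph =
  verts :: "'a set"
  edges :: "'a set set"

definition simple_graph :: "'a ugraph \<Rightarrow> bool" where
  "simple_graph G \<longleftrightarrow>
     (\<forall>e \<in> edges G. \<exists>u \<in> verts G. \<exists>v \<in> verts G. u \<noteq> v \<and> e = {u, v})"

definition adj :: "'a ugraph \<Rightarrow> 'a \<Rightarrow> 'a \<Rightarrow> bool" where
  "adj G u v \<longleftrightarrow> {u, v} \<in> edges G"

definition bipartite_graph :: "'a ugraph \<Rightarrow> 'a set \<Rightarrow> 'a set \<Rightarrow> bool" where
  "bipartite_graph G A B \<longleftrightarrow>
     simple_graph G \<and> A \<union> B = verts G \<and> A \<inter> B = {} \<and>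
     (\<forall>e \<in> edges G. \<exists>a \<in> A. \<exists>b \<in> B. e = {a, b})"

text \<open>Graphs are not required to be finite. Sizes and degrees are therefore extended natural
  numbers, because \<^const>\<open>card\<close> is 0 on infinite sets.\<close>

definition ecard :: "'a set \<Rightarrow> enat" where
  "ecard S = (if finite S then enat (card S) else \<infinity>)"

definition degree :: "'a ugraph \<Rightarrow> 'a \<Rightarrow> enat" where
  "degree G v = ecard {u \<in> verts G. adj G v u}"

text \<open>If the degrees in \<open>S\<close> are bounded and \<open>S\<close> is nonempty, this supremum is attained, so it is
  the maximum; it is 0 for empty \<open>S\<close>.\<close>

definition max_degree_in :: "'a ugraph \<Rightarrow> 'a set \<Rightarrow> enat" where
  "max_degree_in G S = (SUP v \<in> S. degree G v)"

definition edges_between :: "'a ugraph \<Rightarrow> 'a set \<Rightarrow> 'a set \<Rightarrow> 'a set set" where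
  "edges_between G X Y = {e \<in> edges G. \<exists>x \<in> X. \<exists>y \<in> Y. e = {x, y}}"

definition matching :: "'a set set \<Rightarrow> bool" where
  "matching M \<longleftrightarrow> disjoint M"

text \<open>The sets \<open>L v\<close> are nonempty and disjoint over all vertices \<open>v\<close> of \<open>G\<close>, so the last two
  equations say that they partition \<open>A_H\<close> and \<open>B_H\<close> separately.\<close>

definition bipartite_cover ::
  "'a ugraph \<Rightarrow> 'a set \<Rightarrow> 'a set \<Rightarrow> 'b ugraph \<Rightarrow> 'b set \<Rightarrow> 'b set \<Rightarrow> ('a \<Rightarrow> 'b set) \<Rightarrow> bool" where
  "bipartite_cover G A_G B_G H A_H B_H L \<longleftrightarrow>
     (\<forall>v \<in> verts G. L v \<noteq> {}) \<and>
     disjoint_family_on L (verts G) \<and>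
     (\<Union>v \<in> verts G. L v) = verts H \<and>
     (\<forall>v \<in> verts G. \<forall>v' \<in> verts G. \<not> adj G v v' \<longrightarrow> edges_between H (L v) (L v') = {}) \<and>
     (\<Union>v \<in> A_G. L v) = A_H \<and>
     (\<Union>w \<in> B_G. L w) = B_H"

definition bipartite_correspondence_cover ::
  "'a ugraph \<Rightarrow> 'a set \<Rightarrow> 'a set \<Rightarrow> 'b ugraph \<Rightarrow> 'b set \<Rightarrow> 'b set \<Rightarrow> ('a \<Rightarrow> 'b set) \<Rightarrow> bool" where
  "bipartite_correspondence_cover G A_G B_G H A_H B_H L \<longleftrightarrow>
     bipartite_cover G A_G B_G H A_H B_H L \<and>
     (\<forall>v \<in> verts G. \<forall>v' \<in> verts G. adj G v v' \<longrightarrow> matching (edges_between H (L v) (L v')))"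

definition independent_set :: "'a ugraph \<Rightarrow> 'a set \<Rightarrow> bool" where
  "independent_set G S \<longleftrightarrow> S \<subseteq> verts G \<and> (\<forall>x \<in> S. \<forall>y \<in> S. \<not> adj G x y)"

definition independent_transversal ::
  "'a ugraph \<Rightarrow> 'b ugraph \<Rightarrow> ('a \<Rightarrow> 'b set) \<Rightarrow> 'b set \<Rightarrow> bool" where
  "independent_transversal G H L T \<longleftrightarrow>
     independent_set H T \<and> (\<forall>v \<in> verts G. \<exists>!x. x \<in> T \<inter> L v)"

end

theory Submission
  imports Defs "HOL-Analysis.Function_Topology"
begin

text \<open>
  Shrink every list to exactly \<open>k\<close> vertices. Since \<open>H\<close> is bipartite, an independent transversal
  amounts to a choice of one vertex \<open>f w\<close> from each list on the \<open>B\<close> side such that every list on the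
  \<open>A\<close> side keeps a vertex that has no chosen neighbour. Draw the \<open>f w\<close> independently and uniformly.
  A list \<open>L v\<close> with \<open>v\<close> in \<open>A_G\<close> is blocked only if each of its \<open>k\<close> vertices has its unique neighbour
  chosen. By the matching condition no two of these neighbours agree, and distinct neighbours in the
  same list cannot both be chosen; so the \<open>k\<close> neighbours lie in \<open>k\<close> different lists, and \<open>v\<close> is
  blocked with probability at most \<open>1 / k^k\<close>.

  Equivalently, each \<open>v\<close> that can be blocked contributes one clause of a \<open>k\<close>-SAT problem over a
  \<open>k\<close>-letter alphabet: it forbids a single assignment of \<open>k\<close> coordinates. A literal (coordinate \<open>w\<close>,
  letter \<open>c\<close>) comes from an edge at the vertex \<open>c\<close>, so it occurs in at most \<open>\<Delta>\<close> clauses, where \<open>\<Delta>\<close> is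
  the maximum degree in part \<open>B_H\<close>. Hence a clause shares a coordinate with at most \<open>k * k * \<Delta>\<close>
  clauses, itself included, and the symmetric Lovasz local lemma applies as soon as
  \<open>e * k^2 * \<Delta> / k^k \<le> 1\<close>, which is the hypothesis \<open>\<Delta> \<le> k^(k-2) / e\<close>.

  The local lemma (\<open>local_lemma_counting\<close>) is proved by counting in a finite sample space, which
  gives the case of finitely many clauses (\<open>finite_clauses_satisfiable\<close>). The graphs may be infinite;
  as each clause involves finitely many coordinates, each with a finite alphabet, Tychonoff's theorem
  extends the result to arbitrarily many clauses (\<open>clauses_satisfiable\<close>).
\<close>

section \<open>The local lemma for counting measure\<close>

definition avoid :: "'w set \<Rightarrow> ('i \<Rightarrow> 'w set) \<Rightarrow> 'i set \<Rightarrow> 'w set" where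
  "avoid \<Omega> A J = {\<omega> \<in> \<Omega>. \<forall>j\<in>J. \<omega> \<notin> A j}"

lemma avoid_empty: "avoid \<Omega> A {} = \<Omega>"
  by (simp add: avoid_def)

lemma finite_avoid: "finite \<Omega> \<Longrightarrow> finite (avoid \<Omega> A J)"
  by (simp add: avoid_def)

lemma card_avoid_insert:
  assumes "finite \<Omega>"
  shows "real (card (avoid \<Omega> A (insert j M))) = card (avoid \<Omega> A M) - card (A j \<inter> avoid \<Omega> A M)"
proof -
  have "avoid \<Omega> A M = avoid \<Omega> A (insert j M) \<union> A j \<inter> avoid \<Omega> A M"
    and "avoid \<Omega> A (insert j M) \<inter> (A j \<inter> avoid \<Omega> A M) = {}"
    by (auto simp: avoid_def)
  then have "card (avoid \<Omega> A M) = card (avoid \<Omega> A (insert j M)) + card (A j \<inter> avoid \<Omega> A M)"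
    using card_Un_disjoint finite_avoid[OF assms] by (metis finite_Int)
  then show ?thesis by simp
qed

text \<open>The chain rule for conditional probabilities: if each event of \<open>M\<close> has conditional probability
  at most \<open>x\<close> whenever some of the others and all of \<open>K\<close> are avoided, then adding the events of \<open>M\<close>
  one by one loses a factor of at most \<open>1 - x\<close> each.\<close>
lemma card_avoid_chain:
  fixes x :: real
  assumes "finite \<Omega>" "finite M" "x \<le> 1"
    and step: "\<And>j M'. j \<in> M \<Longrightarrow> M' \<subseteq> M - {j} \<Longrightarrow>
      card (A j \<inter> avoid \<Omega> A (M' \<union> K)) \<le> x * card (avoid \<Omega> A (M' \<union> K))"
  shows "(1 - x) ^ card M * card (avoid \<Omega> A K) \<le> card (avoid \<Omega> A (M \<union> K))"
  using assms(2) step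
proof (induction M rule: finite_induct)
  case empty
  show ?case by simp
next
  case (insert j M)
  have IH: "(1 - x) ^ card M * card (avoid \<Omega> A K) \<le> card (avoid \<Omega> A (M \<union> K))"
    by (rule insert.IH) (rule insert.prems; blast)
  have "(1 - x) ^ card (insert j M) * card (avoid \<Omega> A K)
      = (1 - x) * ((1 - x) ^ card M * card (avoid \<Omega> A K))"
    using insert.hyps by simp
  also have "\<dots> \<le> (1 - x) * card (avoid \<Omega> A (M \<union> K))"
    using IH assms(3) by (intro mult_left_mono) auto
  also have "\<dots> \<le> card (avoid \<Omega> A (insert j M \<union> K))"
    using insert.prems[of j M] insert.hyps card_avoid_insert[OF assms(1), of A j "M \<union> K"]
    by (simp add: algebra_simps)
  finally show ?case .
qed

text \<open>The hypothesis \<open>indep\<close> is the one-sided (lopsided) form of independence: avoiding events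
  outside the neighbourhood \<open>N i\<close> does not raise the probability of \<open>A i\<close> above \<open>p\<close>. The induction on
  \<open>card J\<close> shows that conditioned on avoiding any set \<open>J\<close> of events, \<open>A i\<close> has probability at most \<open>x\<close>.
  Only the at most \<open>d\<close> events of \<open>J\<close> in the neighbourhood of \<open>i\<close> matter: conditioning on them in
  addition increases the probability by a factor of at most \<open>1 / (1 - x) ^ d\<close>.\<close>
lemma local_lemma_counting:
  fixes A :: "'i \<Rightarrow> 'w set" and p x :: real
  assumes fin: "finite \<Omega>" "finite I" and ne: "\<Omega> \<noteq> {}"
    and N: "\<And>i. i \<in> I \<Longrightarrow> i \<in> N i" "\<And>i. i \<in> I \<Longrightarrow> N i \<subseteq> I"
      "\<And>i. i \<in> I \<Longrightarrow> card (N i) \<le> Suc d"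
    and indep: "\<And>i J. i \<in> I \<Longrightarrow> J \<subseteq> I - N i \<Longrightarrow>
      card (A i \<inter> avoid \<Omega> A J) \<le> p * card (avoid \<Omega> A J)"
    and x: "0 \<le> x" "x < 1" and p: "0 \<le> p" "p \<le> x * (1 - x) ^ d"
  shows "\<exists>\<omega>\<in>\<Omega>. \<forall>i\<in>I. \<omega> \<notin> A i"
proof -
  have key: "card (A i \<inter> avoid \<Omega> A J) \<le> x * card (avoid \<Omega> A J)" if "J \<subseteq> I" "i \<in> I" for i J
    using that
  proof (induction "card J" arbitrary: i J rule: less_induct)
    case less
    have finJ: "finite J" using less.prems fin(2) finite_subset by blast
    show ?case
    proof (cases "i \<in> J")
      case True
      then have "A i \<inter> avoid \<Omega> A J = {}" by (auto simp: avoid_def)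
      then show ?thesis using x by simp
    next
      case False
      let ?J1 = "J \<inter> N i" and ?J2 = "J - N i"
      have "?J1 \<subseteq> N i - {i}" using False by blast
      then have "card ?J1 \<le> card (N i - {i})"
        using N(2)[OF less.prems(2)] fin(2) by (meson card_mono finite_Diff finite_subset)
      also have "\<dots> \<le> d"
        using N(1,3)[OF less.prems(2)] by (simp add: card_Diff_singleton)
      finally have c: "card ?J1 \<le> d" .
      have "(1 - x) ^ card ?J1 * card (avoid \<Omega> A ?J2) \<le> card (avoid \<Omega> A (?J1 \<union> ?J2))"
      proof (rule card_avoid_chain[OF fin(1)])
        fix j M' assume j: "j \<in> ?J1" and M': "M' \<subseteq> ?J1 - {j}"
        have "M' \<union> ?J2 \<subset> J" using j M' by blast
        then have "card (M' \<union> ?J2) < card J" using finJ by (rule psubset_card_mono[rotated])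
        moreover have "M' \<union> ?J2 \<subseteq> I" "j \<in> I" using j M' less.prems by auto
        ultimately show "card (A j \<inter> avoid \<Omega> A (M' \<union> ?J2)) \<le> x * card (avoid \<Omega> A (M' \<union> ?J2))"
          using less.hyps by blast
      qed (use finJ x in auto)
      moreover have "?J1 \<union> ?J2 = J" by blast
      moreover have "(1 - x) ^ d \<le> (1 - x) ^ card ?J1"
        using x c by (intro power_decreasing) auto
      ultimately have chain: "(1 - x) ^ d * card (avoid \<Omega> A ?J2) \<le> card (avoid \<Omega> A J)"
        by (smt (verit) mult_right_mono of_nat_0_le_iff)
      have "card (A i \<inter> avoid \<Omega> A J) \<le> card (A i \<inter> avoid \<Omega> A ?J2)"
        by (rule card_mono) (auto simp: finite_avoid fin, auto simp: avoid_def)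
      then have "real (card (A i \<inter> avoid \<Omega> A J)) \<le> card (A i \<inter> avoid \<Omega> A ?J2)" by simp
      also have "\<dots> \<le> p * card (avoid \<Omega> A ?J2)"
        using less.prems by (intro indep) auto
      also have "\<dots> \<le> x * (1 - x) ^ d * card (avoid \<Omega> A ?J2)"
        using p by (intro mult_right_mono) auto
      also have "\<dots> \<le> x * card (avoid \<Omega> A J)"
        using chain x by (simp add: mult.assoc mult_left_mono)
      finally show ?thesis .
    qed
  qed
  have "(1 - x) ^ card I * card (avoid \<Omega> A {}) \<le> card (avoid \<Omega> A (I \<union> {}))"
    by (rule card_avoid_chain[OF fin(1,2)]) (use x in \<open>auto intro!: key\<close>)
  moreover have "0 < (1 - x) ^ card I * card \<Omega>"
    using x fin(1) ne by (simp add: card_gt_0_iff)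
  ultimately have "0 < card (avoid \<Omega> A I)"
    by (simp add: avoid_empty)
  then have "avoid \<Omega> A I \<noteq> {}" by auto
  then show ?thesis by (auto simp: avoid_def)
qed

text \<open>The classical choice \<open>x = 1 / (d + 1)\<close> works because \<open>(1 + 1 / d) ^ d \<le> e\<close>. It would give
  \<open>x = 1\<close> for \<open>d = 0\<close>; there \<open>x = 1 / 2\<close> serves instead, as \<open>1 / e \<le> 1 / 2\<close>.\<close>
lemma local_lemma_weight_exists:
  fixes p :: real
  assumes "exp 1 * p * real (Suc d) \<le> 1"
  obtains x where "0 \<le> x" "x < 1" "p \<le> x * (1 - x) ^ d"
proof (cases "d = 0")
  case True
  have "p \<le> 1/2"
  proof (rule ccontr)
    assume "\<not> p \<le> 1/2"
    then have "2 * p \<le> exp 1 * p"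
      using exp_ge_add_one_self[of 1] by (intro mult_right_mono) auto
    moreover have "exp 1 * p \<le> 1" using assms True by simp
    ultimately show False using \<open>\<not> p \<le> 1/2\<close> by linarith
  qed
  then show ?thesis using that[of "1/2"] True by simp
next
  case False
  define x where "x = 1 / real (Suc d)"
  have "(1 + 1 / real d) ^ d \<le> exp (1 / real d) ^ d"
    by (intro power_mono exp_ge_add_one_self) auto
  also have "\<dots> = exp 1"
    using False by (simp flip: exp_of_nat_mult)
  finally have "1 / exp 1 \<le> 1 / (1 + 1 / real d) ^ d"
    by (intro divide_left_mono) (auto intro!: mult_pos_pos zero_less_power add_pos_nonneg)
  also have "\<dots> = (1 - x) ^ d"
    using False by (simp add: x_def field_simps flip: power_one_over power_divide)
  finally have "1 / exp 1 \<le> (1 - x) ^ d" .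
  then have "x * (1 / exp 1) \<le> x * (1 - x) ^ d"
    by (intro mult_left_mono) (auto simp: x_def)
  moreover have "p \<le> x * (1 / exp 1)"
    using assms by (simp add: x_def field_simps del: of_nat_Suc)
  ultimately show ?thesis
    using that[of x] False by (simp add: x_def)
qed

section \<open>Clauses that forbid one assignment of finitely many coordinates\<close>

text \<open>Independence of coordinates in a product space: if the event \<open>C\<close> does not depend on the
  coordinates in \<open>S\<close>, prescribing them has conditional probability at most
  \<open>1 / (\<Prod>w\<in>S. card (K w))\<close>. Indeed, overwriting the prescribed values on \<open>S\<close> by arbitrary ones
  never leaves \<open>C\<close>, and the original point and the new values can both be recovered.\<close>
lemma card_cylinder_Int_le:
  assumes fin: "finite W" "\<And>w. w \<in> W \<Longrightarrow> finite (K w)" and S: "S \<subseteq> W"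
    and C: "C \<subseteq> PiE W K"
    and off: "\<And>f g. f \<in> C \<Longrightarrow> g \<in> PiE W K \<Longrightarrow> (\<And>w. w \<in> W - S \<Longrightarrow> g w = f w) \<Longrightarrow> g \<in> C"
  shows "card ({f \<in> PiE W K. \<forall>w\<in>S. f w = y w} \<inter> C) * (\<Prod>w\<in>S. card (K w)) \<le> card C"
proof -
  let ?X = "{f \<in> PiE W K. \<forall>w\<in>S. f w = y w} \<inter> C"
  let ?h = "\<lambda>(f, g). \<lambda>w. if w \<in> S then g w else f w"
  have finS: "finite S" using S fin(1) finite_subset by blast
  have "finite C" using C fin by (meson finite_PiE finite_subset)
  have "inj_on ?h (?X \<times> PiE S K)"
  proof (rule inj_onI, clarify)
    fix f g f' g'
    assume f: "f \<in> PiE W K" "\<forall>w\<in>S. f w = y w" and f': "f' \<in> PiE W K" "\<forall>w\<in>S. f' w = y w"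
      and g: "g \<in> PiE S K" "g' \<in> PiE S K"
      and eq: "(\<lambda>w. if w \<in> S then g w else f w) = (\<lambda>w. if w \<in> S then g' w else f' w)"
    have "f w = f' w" for w using f(2) f'(2) fun_cong[OF eq, of w] by (cases "w \<in> S") auto
    moreover have "g w = g' w" for w
      using PiE_arb[OF g(1), of w] PiE_arb[OF g(2), of w] fun_cong[OF eq, of w]
      by (cases "w \<in> S") simp_all
    ultimately show "f = f' \<and> g = g'" by (intro conjI ext)
  qed
  moreover have "?h ` (?X \<times> PiE S K) \<subseteq> C"
  proof clarify
    fix f g assume f: "f \<in> PiE W K" "f \<in> C" and g: "g \<in> PiE S K"
    have "(\<lambda>w. if w \<in> S then g w else f w) \<in> PiE W K"
      using f(1) g S by (auto simp: PiE_iff extensional_def)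
    then show "(\<lambda>w. if w \<in> S then g w else f w) \<in> C"
      by (rule off[OF f(2)]) auto
  qed
  ultimately have "card (?X \<times> PiE S K) \<le> card C"
    using \<open>finite C\<close> by (rule card_inj_on_le)
  then show ?thesis
    by (simp add: card_cartesian_product card_PiE[OF finS])
qed

text \<open>Clause \<open>i\<close> forbids the assignment \<open>y i\<close> on the coordinates \<open>S i\<close>; a random assignment violates
  it with probability \<open>1 / q ^ k\<close>. Clauses are neighbours if they share a coordinate. To pick a
  neighbour, choose one of \<open>k\<close> coordinates, one of \<open>q\<close> letters there, and one of at most \<open>\<Delta>\<close> clauses
  containing this literal; this bounds the neighbourhood by \<open>k * q * \<Delta>\<close>.\<close>
lemma finite_clauses_satisfiable:
  fixes y :: "'i \<Rightarrow> 'w \<Rightarrow> 'c"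
  assumes I: "finite I" and "k > 0" "q > 0"
    and S: "\<And>i. i \<in> I \<Longrightarrow> finite (S i) \<and> card (S i) = k"
    and K: "\<And>i w. i \<in> I \<Longrightarrow> w \<in> S i \<Longrightarrow> card (K w) = q \<and> y i w \<in> K w"
    and occ: "\<And>w c. card {i \<in> I. w \<in> S i \<and> y i w = c} \<le> \<Delta>"
    and bound: "exp 1 * real (k * q * \<Delta>) \<le> real q ^ k"
  shows "\<exists>f \<in> PiE (\<Union>i\<in>I. S i) K. \<forall>i\<in>I. \<exists>w\<in>S i. f w \<noteq> y i w"
proof (cases "I = {}")
  case True
  then show ?thesis by auto
next
  case False
  define W where "W = (\<Union>i\<in>I. S i)"
  define \<Omega> where "\<Omega> = PiE W K"
  define A where "A = (\<lambda>i. {f \<in> \<Omega>. \<forall>w\<in>S i. f w = y i w})"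
  define N where "N = (\<lambda>i. {j \<in> I. S i \<inter> S j \<noteq> {}})"
  have finW: "finite W" using I S by (auto simp: W_def)
  have cK: "card (K w) = q" if "w \<in> W" for w using that K by (auto simp: W_def)
  have finK: "finite (K w)" if "w \<in> W" for w using cK[OF that] \<open>q > 0\<close> by (intro card_ge_0_finite) simp
  have neK: "K w \<noteq> {}" if "w \<in> W" for w using cK[OF that] \<open>q > 0\<close> by auto
  have cN: "card (N i) \<le> k * q * \<Delta>" if i: "i \<in> I" for i
  proof -
    have "N i \<subseteq> (\<Union>w\<in>S i. \<Union>c\<in>K w. {j \<in> I. w \<in> S j \<and> y j w = c})"
      using K by (auto simp: N_def)
    then have "card (N i) \<le> card (\<Union>w\<in>S i. \<Union>c\<in>K w. {j \<in> I. w \<in> S j \<and> y j w = c})"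
      by (rule card_mono[rotated]) (rule finite_subset[OF _ I], auto)
    also have "\<dots> \<le> (\<Sum>w\<in>S i. card (\<Union>c\<in>K w. {j \<in> I. w \<in> S j \<and> y j w = c}))"
      using S[OF i] by (intro card_UN_le) auto
    also have "\<dots> \<le> (\<Sum>w\<in>S i. q * \<Delta>)"
    proof (rule sum_mono)
      fix w assume w: "w \<in> S i"
      then have wW: "w \<in> W" using i by (auto simp: W_def)
      have "card (\<Union>c\<in>K w. {j \<in> I. w \<in> S j \<and> y j w = c})
          \<le> (\<Sum>c\<in>K w. card {j \<in> I. w \<in> S j \<and> y j w = c})"
        using finK[OF wW] by (rule card_UN_le)
      also have "\<dots> \<le> (\<Sum>c\<in>K w. \<Delta>)" by (intro sum_mono occ)
      finally show "card (\<Union>c\<in>K w. {j \<in> I. w \<in> S j \<and> y j w = c}) \<le> q * \<Delta>"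
        using cK[OF wW] by simp
    qed
    also have "\<dots> = k * q * \<Delta>" using S[OF i] by simp
    finally show ?thesis .
  qed
  have selfN: "i \<in> N i" if "i \<in> I" for i
    using that S[OF that] \<open>k > 0\<close> by (auto simp: N_def)
  \<comment> \<open>Every clause is its own neighbour, so the bound is positive and \<open>d\<close> can count the others.\<close>
  have "k * q * \<Delta> \<noteq> 0"
  proof -
    obtain i where i: "i \<in> I" using False by blast
    have "finite (N i)" using I by (simp add: N_def)
    then have "0 < card (N i)" using selfN[OF i] card_gt_0_iff by blast
    then show ?thesis using cN[OF i] by linarith
  qed
  then obtain d where d: "k * q * \<Delta> = Suc d" using not0_implies_Suc by blast
  define p where "p = 1 / real q ^ k"
  have "exp 1 * p * real (Suc d) \<le> 1"
    using bound \<open>q > 0\<close> unfolding d p_def by (simp add: field_simps)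
  then obtain x where x: "0 \<le> x" "x < 1" "p \<le> x * (1 - x) ^ d"
    by (rule local_lemma_weight_exists)
  have "\<exists>f\<in>\<Omega>. \<forall>i\<in>I. f \<notin> A i"
  proof (rule local_lemma_counting[where N = N and p = p and x = x and d = d])
    show "finite \<Omega>" using finW finK by (simp add: \<Omega>_def finite_PiE)
    show "\<Omega> \<noteq> {}" using neK by (simp add: \<Omega>_def PiE_eq_empty_iff)
    show "card (N i) \<le> Suc d" if "i \<in> I" for i using cN[OF that] d by simp
    show "real (card (A i \<inter> avoid \<Omega> A J)) \<le> p * real (card (avoid \<Omega> A J))"
      if i: "i \<in> I" and J: "J \<subseteq> I - N i" for i J
    proof -
      have sub: "S i \<subseteq> W" using i by (auto simp: W_def)
      have "card (A i \<inter> avoid \<Omega> A J) * (\<Prod>w\<in>S i. card (K w)) \<le> card (avoid \<Omega> A J)"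
        unfolding A_def[THEN fun_cong, of i] \<Omega>_def
      proof (rule card_cylinder_Int_le[OF finW finK sub])
        fix f g assume f: "f \<in> avoid (PiE W K) A J" and g: "g \<in> PiE W K"
          and eq: "\<And>w. w \<in> W - S i \<Longrightarrow> g w = f w"
        have "g \<notin> A j" if "j \<in> J" for j
        proof -
          have "S j \<subseteq> W - S i" using that J by (auto simp: W_def N_def)
          then have "\<forall>w\<in>S j. g w = f w" using eq by blast
          moreover have "f \<notin> A j" "f \<in> PiE W K" using f that by (auto simp: avoid_def)
          ultimately show ?thesis by (auto simp: A_def \<Omega>_def)
        qed
        then show "g \<in> avoid (PiE W K) A J" using g by (auto simp: avoid_def)
      qed (auto simp: avoid_def)
      moreover have "(\<Prod>w\<in>S i. card (K w)) = q ^ k"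
        using S[OF i] cK sub by (simp add: subset_iff)
      ultimately have "real (card (A i \<inter> avoid \<Omega> A J) * q ^ k) \<le> card (avoid \<Omega> A J)"
        by (metis of_nat_le_iff)
      then show ?thesis using \<open>q > 0\<close> by (simp add: p_def field_simps)
    qed
  qed (use I selfN x \<open>q > 0\<close> in \<open>auto simp: N_def p_def\<close>)
  then show ?thesis by (auto simp: A_def \<Omega>_def W_def)
qed

text \<open>The assignments form a compact product of finite discrete spaces. Those satisfying a given
  clause form a closed set, since satisfaction depends on finitely many coordinates, so the finite
  intersection property applies.\<close>
lemma clauses_satisfiable_compactness:
  fixes y :: "'i \<Rightarrow> 'w \<Rightarrow> 'c"
  assumes K: "\<And>w. w \<in> W \<Longrightarrow> finite (K w)"
    and S: "\<And>i. i \<in> I \<Longrightarrow> finite (S i)" "\<And>i. i \<in> I \<Longrightarrow> S i \<subseteq> W"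
    and sat: "\<And>F. finite F \<Longrightarrow> F \<subseteq> I \<Longrightarrow> \<exists>f \<in> PiE W K. \<forall>i\<in>F. \<exists>w\<in>S i. f w \<noteq> y i w"
  shows "\<exists>f \<in> PiE W K. \<forall>i\<in>I. \<exists>w\<in>S i. f w \<noteq> y i w"
proof -
  define X where "X = product_topology (\<lambda>w. discrete_topology (K w)) W"
  define C where "C = (\<lambda>i. {f \<in> PiE W K. \<exists>w\<in>S i. f w \<noteq> y i w})"
  have top: "topspace X = PiE W K" by (simp add: X_def)
  have "compact_space X"
    unfolding X_def using K
    by (simp add: compact_space_product_topology compact_space_discrete_topology)
  moreover have "closedin X (C i)" if i: "i \<in> I" for i
  proof -
    have eq: "C i = (\<Union>w\<in>S i. {f \<in> topspace X. f w \<in> K w - {y i w}})"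
      using S(2)[OF i] unfolding C_def top by (blast dest: PiE_mem)
    have "closedin X {f \<in> topspace X. f w \<in> K w - {y i w}}" if w: "w \<in> S i" for w
    proof (rule closedin_continuous_map_preimage)
      show "continuous_map X (discrete_topology (K w)) (\<lambda>f. f w)"
        unfolding X_def by (rule continuous_map_product_projection) (use w S(2)[OF i] in blast)
      show "closedin (discrete_topology (K w)) (K w - {y i w})" by auto
    qed
    then show ?thesis unfolding eq using S(1)[OF i] by (intro closedin_Union) auto
  qed
  \<comment> \<open>The whole space is included in the family so that the intersection stays inside it when
    there are no clauses.\<close>
  moreover have "\<Inter>\<F> \<noteq> {}" if \<F>: "finite \<F>" "\<F> \<subseteq> insert (PiE W K) (C ` I)" for \<F>
  proof -
    have "finite (\<F> - {PiE W K})" "\<F> - {PiE W K} \<subseteq> C ` I" using \<F> by auto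
    then obtain F where F: "F \<subseteq> I" "finite F" "\<F> - {PiE W K} = C ` F"
      using finite_subset_image by meson
    then obtain f where "f \<in> PiE W K" "\<forall>i\<in>F. f \<in> C i"
      using sat[of F] by (auto simp: C_def)
    then have "f \<in> B" if "B \<in> insert (PiE W K) (C ` F)" for B using that by blast
    moreover have "\<F> \<subseteq> insert (PiE W K) (C ` F)" unfolding F(3)[symmetric] by blast
    ultimately have "f \<in> \<Inter>\<F>" by (meson InterI subsetD)
    then show ?thesis by blast
  qed
  moreover have "closedin X (PiE W K)" using closedin_topspace[of X] top by simp
  ultimately have "\<Inter>(insert (PiE W K) (C ` I)) \<noteq> {}"
    unfolding compact_space_fip by (elim allE[of _ "insert (PiE W K) (C ` I)"]) auto
  then show ?thesis by (auto simp: C_def)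
qed

lemma clauses_satisfiable:
  fixes y :: "'i \<Rightarrow> 'w \<Rightarrow> 'c"
  assumes "k > 0" "q > 0"
    and K: "\<And>w. w \<in> W \<Longrightarrow> card (K w) = q"
    and S: "\<And>i. i \<in> I \<Longrightarrow> S i \<subseteq> W" "\<And>i. i \<in> I \<Longrightarrow> card (S i) = k"
    and y: "\<And>i w. i \<in> I \<Longrightarrow> w \<in> S i \<Longrightarrow> y i w \<in> K w"
    and occ: "\<And>w c. finite {i \<in> I. w \<in> S i \<and> y i w = c}"
      "\<And>w c. card {i \<in> I. w \<in> S i \<and> y i w = c} \<le> \<Delta>"
    and bound: "exp 1 * real (k * q * \<Delta>) \<le> real q ^ k"
  shows "\<exists>f \<in> PiE W K. \<forall>i\<in>I. \<exists>w\<in>S i. f w \<noteq> y i w"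
proof (rule clauses_satisfiable_compactness)
  show finS: "finite (S i)" if "i \<in> I" for i
    using S(2)[OF that] \<open>k > 0\<close> by (intro card_ge_0_finite) simp
  have K0: "0 < card (K w)" if "w \<in> W" for w using K[OF that] \<open>q > 0\<close> by simp
  then show "finite (K w)" if "w \<in> W" for w using that card_ge_0_finite by blast
  show "\<exists>f \<in> PiE W K. \<forall>i\<in>F. \<exists>w\<in>S i. f w \<noteq> y i w" if F: "finite F" "F \<subseteq> I" for F
  proof -
    have "\<exists>f \<in> PiE (\<Union>i\<in>F. S i) K. \<forall>i\<in>F. \<exists>w\<in>S i. f w \<noteq> y i w"
    proof (rule finite_clauses_satisfiable[OF F(1) assms(1,2)])
      show "card {i \<in> F. w \<in> S i \<and> y i w = c} \<le> \<Delta>" for w c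
        by (rule order_trans[OF card_mono occ(2)[of w c]]) (use occ(1) F in auto)
    next
      fix i w assume "i \<in> F" "w \<in> S i"
      then show "card (K w) = q \<and> y i w \<in> K w" using F(2) S(1) K y by blast
    qed (use F S finS bound in auto)
    then obtain f where f: "f \<in> PiE (\<Union>i\<in>F. S i) K" "\<forall>i\<in>F. \<exists>w\<in>S i. f w \<noteq> y i w" by blast
    \<comment> \<open>Coordinates outside the clauses in \<open>F\<close> are unconstrained and receive arbitrary letters.\<close>
    define g where "g = restrict (\<lambda>w. if w \<in> (\<Union>i\<in>F. S i) then f w else SOME c. c \<in> K w) W"
    have "g \<in> PiE W K"
    proof (intro PiE_I)
      fix w assume w: "w \<in> W"
      have "K w \<noteq> {}" using K0[OF w] by auto
      then show "g w \<in> K w" using w f(1) by (auto simp: g_def PiE_iff some_in_eq)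
    qed (simp add: g_def)
    have "g w = f w" if "i \<in> F" "w \<in> S i" for i w
      using that F S(1) by (auto simp: g_def)
    then have "\<exists>w\<in>S i. g w \<noteq> y i w" if "i \<in> F" for i
      using bspec[OF f(2) that] that by (metis (no_types))
    with \<open>g \<in> PiE W K\<close> show ?thesis by blast
  qed
qed (rule S(1))

section \<open>Correspondence covers and independent transversals\<close>

lemma ecard_le_enat: "ecard X \<le> enat n \<longleftrightarrow> finite X \<and> card X \<le> n"
  by (simp add: ecard_def)

lemma ecard_ge_obtain_subset:
  assumes "enat k \<le> ecard X"
  obtains Y where "Y \<subseteq> X" "finite Y" "card Y = k"
proof (cases "finite X")
  case True
  then have "k \<le> card X" using assms by (simp add: ecard_def)
  then show ?thesis using obtain_subset_with_card_n[of k X] that by metis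
next
  case False
  then show ?thesis using infinite_arbitrarily_large[of X k] that by metis
qed

text \<open>Otherwise two edges of the matching between \<open>L v\<close> and \<open>L w\<close> would share the end \<open>c\<close>. Hence
  the neighbours of the vertices of one list are distinct, and a choice of one vertex per list that
  contains them all must take them from distinct lists.\<close>
lemma correspondence_cover_list_injective:
  assumes cover: "bipartite_correspondence_cover G A_G B_G H A_H B_H L"
    and v: "v \<in> verts G" "w \<in> verts G" "x \<in> L v" "x' \<in> L v" "c \<in> L w"
    and adj: "adj H x c" "adj H x' c" and ne: "x \<noteq> c" "x' \<noteq> c"
  shows "x = x'"
proof -
  have e: "{x, c} \<in> edges_between H (L v) (L w)" "{x', c} \<in> edges_between H (L v) (L w)"
    using v adj by (auto simp: edges_between_def adj_def)
  have "edges_between H (L v) (L w) = {}" if "\<not> adj G v w"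
    using cover v(1,2) that
    by (simp add: bipartite_correspondence_cover_def bipartite_cover_def)
  then have "adj G v w" using e by blast
  then have "disjoint (edges_between H (L v) (L w))"
    using cover v(1,2) by (simp add: bipartite_correspondence_cover_def matching_def)
  then have "{x, c} = {x', c}"
    using disjointD[OF _ e] by blast
  then show ?thesis using ne by (metis doubleton_eq_iff)
qed

lemma bipartite_adj_cases:
  assumes "bipartite_graph H A B" "adj H x y"
  shows "x \<in> A \<and> y \<in> B \<or> x \<in> B \<and> y \<in> A"
  using assms unfolding bipartite_graph_def adj_def by (metis doubleton_eq_iff)

lemma adj_sym: "adj H x y \<longleftrightarrow> adj H y x"
  by (simp add: adj_def insert_commute)

text \<open>All edges of \<open>H\<close> join its two parts, so once the choice \<open>f\<close> on the \<open>B\<close> side is fixed, the lists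
  on the \<open>A\<close> side can be treated separately.\<close>
lemma unblocked_choice_imp_independent_transversal:
  assumes G: "bipartite_graph G A_G B_G" and H: "bipartite_graph H A_H B_H"
    and cover: "bipartite_cover G A_G B_G H A_H B_H L"
    and f: "\<And>w. w \<in> B_G \<Longrightarrow> f w \<in> L w"
    and free: "\<And>v. v \<in> A_G \<Longrightarrow> \<exists>x\<in>L v. \<forall>w\<in>B_G. \<not> adj H x (f w)"
  shows "\<exists>T. independent_transversal G H L T"
proof -
  have vG: "verts G = A_G \<union> B_G" "A_G \<inter> B_G = {}" using G by (auto simp: bipartite_graph_def)
  have vH: "verts H = A_H \<union> B_H" "A_H \<inter> B_H = {}" using H by (auto simp: bipartite_graph_def)
  have LA: "(\<Union>v\<in>A_G. L v) = A_H" and LB: "(\<Union>w\<in>B_G. L w) = B_H"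
    and disj: "disjoint_family_on L (verts G)"
    using cover by (auto simp: bipartite_cover_def)
  obtain g where g: "\<And>v. v \<in> A_G \<Longrightarrow> g v \<in> L v" "\<And>v w. v \<in> A_G \<Longrightarrow> w \<in> B_G \<Longrightarrow> \<not> adj H (g v) (f w)"
    using free by metis
  define t where "t = (\<lambda>v. if v \<in> A_G then g v else f v)"
  have t: "t v \<in> L v" if "v \<in> verts G" for v using that f g vG by (auto simp: t_def)
  have side: "t v \<in> A_H \<longleftrightarrow> v \<in> A_G" "t v \<in> B_H \<longleftrightarrow> v \<in> B_G" if "v \<in> verts G" for v
    using t[OF that] that vG vH LA LB by blast+
  have "\<not> adj H (t v) (t w)" if vw: "v \<in> verts G" "w \<in> verts G" for v w
  proof
    assume a: "adj H (t v) (t w)"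
    then consider "v \<in> A_G" "w \<in> B_G" | "v \<in> B_G" "w \<in> A_G"
      using bipartite_adj_cases[OF H a] side vw by blast
    then show False
    proof cases
      case 1
      then have "w \<notin> A_G" using vG by blast
      then show False using 1 a g(2) by (simp add: t_def)
    next
      case 2
      then have "v \<notin> A_G" using vG by blast
      then show False using 2 a g(2) adj_sym[of H] by (simp add: t_def)
    qed
  qed
  then have "independent_set H (t ` verts G)"
    using side vG vH by (auto simp: independent_set_def)
  moreover have "\<exists>!x. x \<in> t ` verts G \<inter> L v" if v: "v \<in> verts G" for v
  proof (rule ex1I[of _ "t v"])
    fix x assume "x \<in> t ` verts G \<inter> L v"
    then obtain u where u: "u \<in> verts G" "x = t u" "x \<in> L v" by auto
    then have "L u \<inter> L v \<noteq> {}" using t by blast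
    then have "u = v" using disjoint_family_onD[OF disj u(1) v] by blast
    then show "x = t v" using u by simp
  qed (use t v in auto)
  ultimately show ?thesis unfolding independent_transversal_def by blast
qed

theorem corollary8:
  fixes k :: nat
    and G :: "'a ugraph" and A_G B_G :: "'a set"
    and H :: "'b ugraph" and A_H B_H :: "'b set"
    and L :: "'a \<Rightarrow> 'b set"
  assumes "k > 0"
    and "bipartite_graph G A_G B_G"
    and "bipartite_graph H A_H B_H"
    and "bipartite_correspondence_cover G A_G B_G H A_H B_H L"
    and "max_degree_in H A_H = 1"
    and "ereal_of_enat (max_degree_in H B_H) \<le> ereal (real k powi (int k - 2) / exp 1)"
    and "\<And>v. v \<in> verts G \<Longrightarrow> ecard (L v) \<ge> enat k"
  shows "\<exists>T. independent_transversal G H L T"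
proof -
  note G = assms(2) and H = assms(3) and cover = assms(4)
  have cover': "bipartite_cover G A_G B_G H A_H B_H L"
    using cover by (simp add: bipartite_correspondence_cover_def)
  have vG: "verts G = A_G \<union> B_G" "A_G \<inter> B_G = {}" using G by (auto simp: bipartite_graph_def)
  have vH: "verts H = A_H \<union> B_H" "A_H \<inter> B_H = {}" using H by (auto simp: bipartite_graph_def)
  have LA: "(\<Union>v\<in>A_G. L v) = A_H" and LB: "(\<Union>w\<in>B_G. L w) = B_H"
    and disj: "disjoint_family_on L (verts G)"
    using cover' by (auto simp: bipartite_cover_def)
  have owner: "u = v" if "u \<in> verts G" "v \<in> verts G" "x \<in> L u" "x \<in> L v" for u v x
    using disjoint_family_onD[OF disj that(1,2)] that by blast

  obtain \<Delta> where \<Delta>: "max_degree_in H B_H = enat \<Delta>"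
    using assms(6) by (cases "max_degree_in H B_H") auto
  have "real \<Delta> \<le> real k powi (int k - 2) / exp 1"
    using assms(6) by (simp add: \<Delta>)
  then have "exp 1 * real (k * k * \<Delta>) \<le> real k powi 2 * real k powi (int k - 2)"
    using \<open>k > 0\<close> by (simp add: field_simps power2_eq_square)
  also have "\<dots> = real k ^ k"
    using \<open>k > 0\<close> power_int_add[of "real k" 2 "int k - 2"] by simp
  finally have bound: "exp 1 * real (k * k * \<Delta>) \<le> real k ^ k" .

  have degB: "finite {x \<in> verts H. adj H c x} \<and> card {x \<in> verts H. adj H c x} \<le> \<Delta>"
    if "c \<in> B_H" for c
    using SUP_upper[OF that, of "Defs.degree H"] \<Delta>
    by (simp add: max_degree_in_def Defs.degree_def ecard_le_enat)
  have nbr_unique: "c = c'" if "x \<in> A_H" "adj H x c" "adj H x c'" "c \<in> verts H" "c' \<in> verts H" for x c c'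
  proof -
    have "ecard {u \<in> verts H. adj H x u} \<le> enat 1"
      using SUP_upper[OF that(1), of "Defs.degree H"] assms(5)
      by (simp add: max_degree_in_def Defs.degree_def one_enat_def)
    then have "\<forall>u\<in>{u \<in> verts H. adj H x u}. \<forall>u'\<in>{u \<in> verts H. adj H x u}. u = u'"
      using card_le_Suc0_iff_eq by (auto simp: ecard_le_enat)
    then show ?thesis using that by blast
  qed

  have "\<exists>Y. Y \<subseteq> L v \<and> finite Y \<and> card Y = k" if "v \<in> verts G" for v
    using ecard_ge_obtain_subset[OF assms(7)[OF that]] by metis
  then obtain K where K: "\<And>v. v \<in> verts G \<Longrightarrow> K v \<subseteq> L v" "\<And>v. v \<in> verts G \<Longrightarrow> finite (K v)"
      "\<And>v. v \<in> verts G \<Longrightarrow> card (K v) = k"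
    by metis

  \<comment> \<open>Vertices \<open>v\<close> that no assignment blocks impose no condition. For the others, any blocking
    assignment \<open>y v\<close> determines the clause: all blocking assignments agree with it on \<open>S v\<close>.\<close>
  define blocks where "blocks = (\<lambda>f v. f \<in> PiE B_G K \<and> (\<forall>x\<in>K v. \<exists>w\<in>B_G. adj H x (f w)))"
  define I where "I = {v \<in> A_G. \<exists>f. blocks f v}"
  define y where "y = (\<lambda>v. SOME f. blocks f v)"
  define S where "S = (\<lambda>v. {w \<in> B_G. \<exists>x\<in>K v. adj H x (y v w)})"
  have y: "blocks (y v) v" if "v \<in> I" for v
    using that someI_ex[of "\<lambda>f. blocks f v"] by (simp add: I_def y_def)
  have yK: "y v w \<in> K w" if "v \<in> I" "w \<in> B_G" for v w
    using y[OF that(1)] that(2) by (auto simp: blocks_def)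
  have KB: "c \<in> B_H" if "w \<in> B_G" "c \<in> K w" for w c using that K(1) vG LB by blast
  have KA: "x \<in> A_H" if "v \<in> A_G" "x \<in> K v" for v x using that K(1) vG LA by blast

  have "\<exists>f \<in> PiE B_G K. \<forall>v\<in>I. \<exists>w\<in>S v. f w \<noteq> y v w"
  proof (rule clauses_satisfiable[OF \<open>k > 0\<close> \<open>k > 0\<close>])
    show "card (S v) = k" if v: "v \<in> I" for v
    proof -
      have vA: "v \<in> A_G" using v by (simp add: I_def)
      have "\<forall>x\<in>K v. \<exists>w\<in>B_G. adj H x (y v w)" using y[OF v] by (simp add: blocks_def)
      then obtain h where h: "\<And>x. x \<in> K v \<Longrightarrow> h x \<in> B_G" "\<And>x. x \<in> K v \<Longrightarrow> adj H x (y v (h x))"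
        by metis
      \<comment> \<open>Injective by the matching condition, surjective since vertices in \<open>A_H\<close> have at most one
        neighbour.\<close>
      have "bij_betw h (K v) (S v)"
      proof (intro bij_betwI' )
        fix x x' assume x: "x \<in> K v" "x' \<in> K v"
        show "h x = h x' \<longleftrightarrow> x = x'"
        proof
          assume eq: "h x = h x'"
          let ?c = "y v (h x)"
          have cK: "?c \<in> K (h x)" using yK[OF v h(1)[OF x(1)]] .
          have "?c \<notin> A_H" using KB[OF h(1)[OF x(1)] cK] vH(2) by blast
          then have "x \<noteq> ?c" "x' \<noteq> ?c" using KA[OF vA] x by metis+
          then show "x = x'"
            using correspondence_cover_list_injective[OF cover, of v "h x" x x' ?c]
              cK K(1) x h vA vG eq by (metis UnCI subsetD)
        qed simp
      next
        fix w assume "w \<in> S v"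
        then obtain x where x: "w \<in> B_G" "x \<in> K v" "adj H x (y v w)" by (auto simp: S_def)
        have "y v w = y v (h x)"
          using nbr_unique[OF KA[OF vA x(2)] x(3) h(2)[OF x(2)]]
            KB[OF x(1) yK[OF v x(1)]] KB[OF h(1)[OF x(2)] yK[OF v h(1)[OF x(2)]]] vH by blast
        then have "w = h x"
          using owner[of w "h x" "y v w"] yK[OF v] x h(1) K(1) vG by (metis UnCI subsetD)
        then show "\<exists>x\<in>K v. w = h x" using x by blast
      qed (use h in \<open>auto simp: S_def\<close>)
      then show ?thesis using bij_betw_same_card K(3) vA vG by fastforce
    qed
    have occ: "finite {v \<in> I. w \<in> S v \<and> y v w = c} \<and> card {v \<in> I. w \<in> S v \<and> y v w = c} \<le> \<Delta>"
      for w c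
    proof (cases "{v \<in> I. w \<in> S v \<and> y v w = c} = {}")
      case False
      then have c: "c \<in> B_H" using KB yK by (auto simp: S_def)
      let ?V = "{v \<in> I. w \<in> S v \<and> y v w = c}"
      have "\<forall>v\<in>?V. \<exists>x. x \<in> K v \<and> adj H x c" unfolding S_def by blast
      then obtain h where h: "\<And>v. v \<in> ?V \<Longrightarrow> h v \<in> K v" "\<And>v. v \<in> ?V \<Longrightarrow> adj H (h v) c"
        using bchoice[of ?V "\<lambda>v x. x \<in> K v \<and> adj H x c"] by blast
      have V: "v \<in> A_G" "v \<in> verts G" if "v \<in> ?V" for v using that vG by (auto simp: I_def)
      \<comment> \<open>The lists are disjoint, so distinct clauses with this literal use distinct edges at \<open>c\<close>.\<close>
      have inj: "inj_on h ?V"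
      proof (rule inj_onI)
        fix v v' assume v: "v \<in> ?V" "v' \<in> ?V" "h v = h v'"
        then show "v = v'"
          using owner[OF V(2)[OF v(1)] V(2)[OF v(2)], of "h v"] h(1)[OF v(1)] h(1)[OF v(2)] K(1) V(2)
          by (metis subsetD)
      qed
      moreover have "h ` ?V \<subseteq> {x \<in> verts H. adj H c x}"
        using h V KA vH adj_sym[of H] by blast
      ultimately show ?thesis
        using degB[OF c] card_inj_on_le[OF inj] by (meson inj_on_finite order_trans)
    next
      case True
      show ?thesis unfolding True by simp
    qed
    show "finite {v \<in> I. w \<in> S v \<and> y v w = c}" for w c using occ by blast
    show "card {v \<in> I. w \<in> S v \<and> y v w = c} \<le> \<Delta>" for w c using occ by blast
    show "card (K w) = k" if "w \<in> B_G" for w using K(3)[of w] that vG(1) by simp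
    show "S v \<subseteq> B_G" for v unfolding S_def by (rule Collect_restrict)
    show "y v w \<in> K w" if "v \<in> I" "w \<in> S v" for v w using yK[OF that(1)] that(2) by (simp add: S_def)
  qed (rule bound)
  then obtain f where f: "f \<in> PiE B_G K" "\<And>v. v \<in> I \<Longrightarrow> \<exists>w\<in>S v. f w \<noteq> y v w" by blast

  have "\<exists>x\<in>L v. \<forall>w\<in>B_G. \<not> adj H x (f w)" if v: "v \<in> A_G" for v
  proof (rule ccontr)
    assume contra: "\<not> (\<exists>x\<in>L v. \<forall>w\<in>B_G. \<not> adj H x (f w))"
    then have blocked: "\<forall>x\<in>K v. \<exists>w\<in>B_G. adj H x (f w)" using K(1) v vG by blast
    then have vI: "v \<in> I" using v f(1) by (auto simp: I_def blocks_def)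
    then obtain w where w: "w \<in> S v" "f w \<noteq> y v w" using f(2) by blast
    then obtain x where x: "x \<in> K v" "adj H x (y v w)" "w \<in> B_G" by (auto simp: S_def)
    obtain w' where w': "w' \<in> B_G" "adj H x (f w')" using blocked x by blast
    have fw': "f w' \<in> K w'" using f(1) w' by auto
    \<comment> \<open>If \<open>f\<close> blocked \<open>v\<close>, it would agree with \<open>y v\<close> on all of \<open>S v\<close>, since both must choose the
      unique neighbour of \<open>x\<close>.\<close>
    have "f w' = y v w"
      using nbr_unique[OF KA[OF v x(1)] w'(2) x(2)] KB[OF w'(1) fw'] KB[OF x(3) yK[OF vI x(3)]] vH
      by blast
    then have "w' = w"
      using owner[of w' w "f w'"] fw' yK[OF vI x(3)] K(1) w' x vG by (metis UnCI subsetD)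
    then show False using w \<open>f w' = y v w\<close> by simp
  qed
  moreover have "f w \<in> L w" if "w \<in> B_G" for w using f(1) that K(1) vG by blast
  ultimately show ?thesis
    by (rule unblocked_choice_imp_independent_transversal[OF G H cover', rotated])
qed

end
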